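(* Every self-adjoint square matrix $H$ over the $*$-algebra $(Cl_{0,1,1}(\mathbb R),*_{-1})$ described in the context is unitarily similar to a direct sum of matrices each of the form $\begin{pmatrix}\lambda_i & -\lambda'_i\delta\\ \lambda'_i\delta & \lambda_i\end{pmatrix}$ or $(\lambda_i)$, where $\lambda_i\in\mathbb R$ and $\lambda'_i\in\mathbb R$, $\lambda'_i>0$.
   Context: The real associative unital algebra $Cl_{0,1,1}(\mathbb R)$ has elements written uniquely as $w+z\delta$ with $w,z\in\mathbb C$, where multiplication extends that of $\mathbb C$ and is determined by $\delta^2=0$ and $\delta z=\overline z\,\delta$ for $z\in\mathbb C$. The involution here is $(w+z\delta)^{*_{-1}}=\overline w-z\delta$ (so $\delta^{*_{-1}}=-\delta$). For a matrix $M$, $(M^* )_{ij}=(M_{ji})^{*_{-1}}$; $M$ is self-adjoint if $M^*=M$; a square matrix $U$ is unitary if $U^*=U^{-1}$; $M$ and $K$ are unitarily similar if $K=UMU^*$ for some unitary $U$. *)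

theory Defs
  imports Complex_Main "Jordan_Normal_Form.Matrix"
begin

text \<open>The real algebra \<open>Cl\<^sub>0\<^sub>,\<^sub>1\<^sub>,\<^sub>1(\<real>)\<close>; the value \<open>Cl w z\<close> stands for \<open>w + z\<delta>\<close> with
  complex \<open>w\<close> and \<open>z\<close>.\<close>

datatype cl011 = Cl (cl_fst: complex) (cl_snd: complex)

instantiation cl011 :: real_algebra_1
begin

definition "0 = Cl 0 0"
definition "1 = Cl 1 0"
definition "a + b = Cl (cl_fst a + cl_fst b) (cl_snd a + cl_snd b)"
definition "- a = Cl (- cl_fst a) (- cl_snd a)"
definition "a - b = Cl (cl_fst a - cl_fst b) (cl_snd a - cl_snd b)"
definition "r *\<^sub>R a = Cl (r *\<^sub>R cl_fst a) (r *\<^sub>R cl_snd a)"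

text \<open>Since \<open>\<delta>w = cnj w \<delta>\<close> and \<open>\<delta>\<^sup>2 = 0\<close>, we have
  \<open>(w + z\<delta>)(w' + z'\<delta>) = ww' + (wz' + z cnj w')\<delta>\<close>.\<close>

definition
  "a * b = Cl (cl_fst a * cl_fst b) (cl_fst a * cl_snd b + cl_snd a * cnj (cl_fst b))"

instance
  by standard
    (simp_all add: zero_cl011_def one_cl011_def plus_cl011_def uminus_cl011_def
      minus_cl011_def scaleR_cl011_def times_cl011_def algebra_simps)

end

definition cl_of_complex :: "complex \<Rightarrow> cl011" where
  "cl_of_complex w = Cl w 0"

definition cl_delta :: cl011 where
  "cl_delta = Cl 0 1"

lemmas cl011_defs = zero_cl011_def one_cl011_def plus_cl011_def uminus_cl011_def
  minus_cl011_def scaleR_cl011_def times_cl011_def cl_of_complex_def cl_delta_def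

lemma cl_of_complex_hom:
  "cl_of_complex (w + z) = cl_of_complex w + cl_of_complex z"
  "cl_of_complex (w * z) = cl_of_complex w * cl_of_complex z"
  "cl_of_complex (of_real r) = of_real r"
  by (simp_all add: cl011_defs of_real_def)

lemma cl_delta_sq: "cl_delta * cl_delta = 0"
  by (simp add: cl011_defs)

lemma cl_delta_commute: "cl_delta * cl_of_complex z = cl_of_complex (cnj z) * cl_delta"
  by (simp add: cl011_defs)

lemma cl011_normal_form:
  "\<exists>!(w, z). a = cl_of_complex w + cl_of_complex z * cl_delta"
  by (cases a) (auto simp: cl011_defs)

definition cl_star :: "cl011 \<Rightarrow> cl011" where
  "cl_star a = Cl (cnj (cl_fst a)) (- cl_snd a)"

lemma cl_star_normal_form:
  "cl_star (cl_of_complex w + cl_of_complex z * cl_delta) =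
    cl_of_complex (cnj w) - cl_of_complex z * cl_delta"
  by (simp add: cl_star_def cl011_defs)

lemma cl_star_involution:
  "cl_star (cl_star a) = a"
  "cl_star (a + b) = cl_star a + cl_star b"
  "cl_star (r *\<^sub>R a) = r *\<^sub>R cl_star a"
  "cl_star (a * b) = cl_star b * cl_star a"
  by (simp_all add: cl_star_def cl011_defs algebra_simps)

definition mat_star :: "cl011 mat \<Rightarrow> cl011 mat" where
  "mat_star M = mat (dim_col M) (dim_row M) (\<lambda>(i, j). cl_star (M $$ (j, i)))"

definition self_adjoint_mat :: "cl011 mat \<Rightarrow> bool" where
  "self_adjoint_mat M \<longleftrightarrow> mat_star M = M"

text \<open>\<open>inverts_mat\<close> expresses a one-sided inverse; \<open>U\<^sup>* = U\<^sup>-\<^sup>1\<close> is a two-sided one.\<close>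

definition unitary_mat :: "cl011 mat \<Rightarrow> bool" where
  "unitary_mat U \<longleftrightarrow>
    square_mat U \<and> inverts_mat U (mat_star U) \<and> inverts_mat (mat_star U) U"

definition unitarily_similar :: "cl011 mat \<Rightarrow> cl011 mat \<Rightarrow> bool" where
  "unitarily_similar M K \<longleftrightarrow>
    (\<exists>n U. M \<in> carrier_mat n n \<and> K \<in> carrier_mat n n \<and> U \<in> carrier_mat n n \<and>
      unitary_mat U \<and> K = U * M * mat_star U)"

definition real_block :: "real \<Rightarrow> cl011 mat" where
  "real_block l = mat_of_rows_list 1 [[of_real l]]"

definition delta_block :: "real \<Rightarrow> real \<Rightarrow> cl011 mat" where
  "delta_block l l' = mat_of_rows_list 2
    [[of_real l, - (l' *\<^sub>R cl_delta)],
     [l' *\<^sub>R cl_delta, of_real l]]"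

end

theory Submission
  imports Defs "Jordan_Normal_Form.Spectral_Radius"
begin

text \<open>Write \<open>H = A + B\<delta>\<close> with complex matrices \<open>A\<close> Hermitian and \<open>B\<close> antisymmetric. A complex unitary
  \<open>V\<close> acts by \<open>A \<mapsto> VAV\<^sup>*\<close>, \<open>B \<mapsto> VBV\<^sup>T\<close>. Once \<open>A\<close> is real diagonal, conjugation by \<open>1 + W\<delta>\<close> for a
  suitable symmetric \<open>W\<close> removes every \<open>B\<^sub>i\<^sub>j\<close> with \<open>a\<^sub>i \<noteq> a\<^sub>j\<close>, which means \<open>AB = B conj(A)\<close>. Under this
  commutation \<open>A\<close> and the antilinear map \<open>x \<mapsto> B conj(x)\<close> have a common reducing subspace of
  dimension one or two, giving a block to split off. The case \<open>B = 0\<close> of that induction is the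
  spectral theorem, so it also supplies the initial diagonalisation of \<open>A\<close>.\<close>

section \<open>Complex parts of matrices and unitary similarity\<close>

abbreviation fst_mat :: "cl011 mat \<Rightarrow> complex mat" where
  "fst_mat \<equiv> map_mat cl_fst"

abbreviation snd_mat :: "cl011 mat \<Rightarrow> complex mat" where
  "snd_mat \<equiv> map_mat cl_snd"

abbreviation cnj_mat :: "complex mat \<Rightarrow> complex mat" where
  "cnj_mat \<equiv> map_mat cnj"

abbreviation adj :: "complex mat \<Rightarrow> complex mat" where
  "adj A \<equiv> cnj_mat (transpose_mat A)"

abbreviation cl_mat :: "complex mat \<Rightarrow> cl011 mat" where
  "cl_mat \<equiv> map_mat cl_of_complex"

lemma cl_simps [simp]:
  "cl_fst 0 = 0" "cl_snd 0 = 0" "cl_fst 1 = 1" "cl_snd 1 = 0"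
  "cl_fst (a + b) = cl_fst a + cl_fst b" "cl_snd (a + b) = cl_snd a + cl_snd b"
  "cl_fst (- a) = - cl_fst a" "cl_snd (- a) = - cl_snd a"
  "cl_fst (a * b) = cl_fst a * cl_fst b"
  "cl_snd (a * b) = cl_fst a * cl_snd b + cl_snd a * cnj (cl_fst b)"
  "cl_fst (cl_star a) = cnj (cl_fst a)" "cl_snd (cl_star a) = - cl_snd a"
  "cl_fst (cl_of_complex w) = w" "cl_snd (cl_of_complex w) = 0"
  by (simp_all add: cl011_defs cl_star_def)

lemma cl_sum [simp]:
  "cl_fst (sum f A) = (\<Sum>i\<in>A. cl_fst (f i))" "cl_snd (sum f A) = (\<Sum>i\<in>A. cl_snd (f i))"
  by (induction A rule: infinite_finite_induct; simp)+

lemma cl_mat_eqI: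
  assumes "fst_mat M = fst_mat K" and "snd_mat M = snd_mat K"
  shows "M = K"
proof (rule eq_matI)
  have d: "dim_row M = dim_row K" "dim_col M = dim_col K"
    using assms(1) by (metis index_map_mat(2,3))+
  show "dim_row M = dim_row K" "dim_col M = dim_col K" by (rule d)+
  fix i j assume ij: "i < dim_row K" "j < dim_col K"
  have "fst_mat M $$ (i, j) = fst_mat K $$ (i, j)" "snd_mat M $$ (i, j) = snd_mat K $$ (i, j)"
    using assms by simp_all
  with ij d show "M $$ (i, j) = K $$ (i, j)" by (simp add: cl011.expand)
qed

lemma fst_mat_mult:
  assumes "M \<in> carrier_mat m n" and "K \<in> carrier_mat n k"
  shows "fst_mat (M * K) = fst_mat M * fst_mat K"
  using assms by (intro eq_matI) (auto simp: scalar_prod_def)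

text \<open>The conjugate arises because \<delta> moves to the right past the complex part of
  \<open>K\<close>.\<close>

lemma snd_mat_mult:
  assumes "M \<in> carrier_mat m n" and "K \<in> carrier_mat n k"
  shows "snd_mat (M * K) = fst_mat M * snd_mat K + snd_mat M * cnj_mat (fst_mat K)"
  using assms by (intro eq_matI) (auto simp: scalar_prod_def sum.distrib)

lemma cnj_mat_mult:
  assumes "A \<in> carrier_mat m n" and "B \<in> carrier_mat n k"
  shows "cnj_mat (A * B) = cnj_mat A * cnj_mat B"
  using assms by (intro eq_matI) (auto simp: scalar_prod_def)

lemma cnj_cnj_mat [simp]: "cnj_mat (cnj_mat A) = A"
  by (intro eq_matI) auto

lemma transpose_cnj_mat: "transpose_mat (cnj_mat A) = adj A"
  by (intro eq_matI) auto

lemma mat_star_carrier [simp]: "mat_star M \<in> carrier_mat n m \<longleftrightarrow> M \<in> carrier_mat m n"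
  unfolding mat_star_def carrier_mat_def by auto

lemma mat_star_dim [simp]: "dim_row (mat_star M) = dim_col M" "dim_col (mat_star M) = dim_row M"
  unfolding mat_star_def by auto

lemma mat_star_index [simp]:
  "i < dim_col M \<Longrightarrow> j < dim_row M \<Longrightarrow> mat_star M $$ (i, j) = cl_star (M $$ (j, i))"
  unfolding mat_star_def by auto

lemma fst_mat_star [simp]: "fst_mat (mat_star M) = adj (fst_mat M)"
  by (intro eq_matI) auto

lemma snd_mat_star [simp]: "snd_mat (mat_star M) = - transpose_mat (snd_mat M)"
  by (intro eq_matI) auto

lemma mat_star_mat_star [simp]: "mat_star (mat_star M) = M"
  by (intro eq_matI) (auto simp: cl_star_involution)

lemma cl_star_simps [simp]: "cl_star 0 = 0" "cl_star 1 = 1"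
  by (simp_all add: cl_star_def cl011_defs)

lemma cl_star_sum: "cl_star (sum f A) = (\<Sum>i\<in>A. cl_star (f i))"
  by (induction A rule: infinite_finite_induct) (simp_all add: cl_star_involution)

lemma mat_star_mult:
  assumes "M \<in> carrier_mat m n" and "K \<in> carrier_mat n k"
  shows "mat_star (M * K) = mat_star K * mat_star M"
  using assms by (intro eq_matI) (auto simp: scalar_prod_def cl_star_sum cl_star_involution)

lemma fst_cl_mat [simp]: "fst_mat (cl_mat A) = A"
  by (intro eq_matI) auto

lemma snd_cl_mat: "A \<in> carrier_mat m n \<Longrightarrow> snd_mat (cl_mat A) = 0\<^sub>m m n"
  by (intro eq_matI) auto

lemma mat_star_cl_mat: "mat_star (cl_mat A) = cl_mat (adj A)"
  by (intro eq_matI) (auto simp: cl_star_def cl_of_complex_def)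

lemma cl_mat_mult:
  assumes "A \<in> carrier_mat m n" and "B \<in> carrier_mat n k"
  shows "cl_mat (A * B) = cl_mat A * cl_mat B"
  using assms
  by (intro cl_mat_eqI)
    (simp_all add: fst_mat_mult[of _ m n _ k] snd_mat_mult[of _ m n _ k] snd_cl_mat[of _ m n]
      snd_cl_mat[of _ n k] snd_cl_mat[of _ m k])

lemma cl_mat_one [simp]: "cl_mat (1\<^sub>m n) = 1\<^sub>m n"
  by (intro eq_matI) (auto simp: cl_of_complex_def cl011_defs)

lemma unitary_mat_iff:
  assumes "U \<in> carrier_mat n n"
  shows "unitary_mat U \<longleftrightarrow> U * mat_star U = 1\<^sub>m n \<and> mat_star U * U = 1\<^sub>m n"
  using assms unfolding unitary_mat_def inverts_mat_def by auto

text \<open>A one-sided inverse of a square complex matrix is two-sided, so one equation is enough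
  to describe a complex unitary.\<close>

lemma unitary_cl_mat:
  assumes "V \<in> carrier_mat n n" and "V * adj V = 1\<^sub>m n"
  shows "unitary_mat (cl_mat V)"
proof -
  have "adj V * V = 1\<^sub>m n" by (rule mat_mult_left_right_inverse) (use assms in auto)
  then show ?thesis using assms
    by (subst unitary_mat_iff[of _ n])
      (auto simp: mat_star_cl_mat simp flip: cl_mat_mult[of _ n n _ n])
qed

lemma unitary_mat_mult:
  assumes c: "U \<in> carrier_mat n n" "W \<in> carrier_mat n n"
    and u: "unitary_mat U" "unitary_mat W"
  shows "unitary_mat (U * W)"
proof -
  have s: "mat_star U \<in> carrier_mat n n" "mat_star W \<in> carrier_mat n n" using c by auto
  have "U * W * (mat_star W * mat_star U) = U * (W * mat_star W) * mat_star U"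
    using c s by (simp add: assoc_mult_mat[of _ n n _ n _ n])
  moreover have "mat_star W * mat_star U * (U * W) = mat_star W * (mat_star U * U) * W"
    using c s by (simp add: assoc_mult_mat[of _ n n _ n _ n])
  ultimately show ?thesis using c s u
    by (simp add: unitary_mat_iff[of _ n] mat_star_mult[of _ n n _ n])
qed

lemma unitarily_similarI:
  assumes "M \<in> carrier_mat n n" and "U \<in> carrier_mat n n" and "unitary_mat U"
  shows "unitarily_similar M (U * M * mat_star U)"
  unfolding unitarily_similar_def using assms
  by (intro exI[of _ n] exI[of _ U]) auto

text \<open>The size hidden in \<open>unitarily_similar\<close> is forced to be that of
  \<open>M\<close>.\<close>

lemma unitarily_similar_carrier:
  assumes "unitarily_similar M K" and "M \<in> carrier_mat n n"
  obtains U where "K \<in> carrier_mat n n" "U \<in> carrier_mat n n" "unitary_mat U"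
    "K = U * M * mat_star U"
  using assms unfolding unitarily_similar_def by (metis carrier_matD(1))

lemma unitarily_similar_trans:
  assumes "unitarily_similar M K" and "unitarily_similar K L"
  shows "unitarily_similar M L"
proof -
  obtain n U where c: "M \<in> carrier_mat n n" "K \<in> carrier_mat n n" "U \<in> carrier_mat n n"
    and U: "unitary_mat U" "K = U * M * mat_star U"
    using assms(1) unfolding unitarily_similar_def by blast
  obtain W where W: "W \<in> carrier_mat n n" "unitary_mat W" "L = W * K * mat_star W"
    using unitarily_similar_carrier[OF assms(2) c(2)] by metis
  have s: "mat_star U \<in> carrier_mat n n" "mat_star W \<in> carrier_mat n n" using c W by auto
  have "L = (W * U) * M * mat_star (W * U)"
    using c W U s by (simp add: mat_star_mult[of _ n n _ n] assoc_mult_mat[of _ n n _ n _ n])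
  then show ?thesis
    using unitarily_similarI[of M n "W * U"] unitary_mat_mult[OF W(1) c(3) W(2) U(1)] c W by auto
qed

lemma unitarily_similar_self_adjoint:
  assumes "unitarily_similar M K" and "self_adjoint_mat M"
  shows "self_adjoint_mat K"
proof -
  obtain n U where c: "M \<in> carrier_mat n n" "K \<in> carrier_mat n n" "U \<in> carrier_mat n n"
    and U: "unitary_mat U" "K = U * M * mat_star U"
    using assms(1) unfolding unitarily_similar_def by blast
  have s: "mat_star U \<in> carrier_mat n n" using c by auto
  then show ?thesis using assms(2) c U(2) unfolding self_adjoint_mat_def
    by (simp add: mat_star_mult[of _ n n _ n] assoc_mult_mat[of _ n n _ n _ n])
qed

section \<open>Block diagonal matrices and unitary similarity\<close>

lemma mat_star_four_block:
  assumes "A \<in> carrier_mat k k" and "D \<in> carrier_mat m m"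
  shows "mat_star (four_block_mat A (0\<^sub>m k m) (0\<^sub>m m k) D) =
    four_block_mat (mat_star A) (0\<^sub>m k m) (0\<^sub>m m k) (mat_star D)"
  using assms by (intro eq_matI) auto

lemma mult_block_diag:
  assumes "A1 \<in> carrier_mat k k" "A2 \<in> carrier_mat k k" "D1 \<in> carrier_mat m m" "D2 \<in> carrier_mat m m"
  shows "four_block_mat A1 (0\<^sub>m k m) (0\<^sub>m m k) D1 * four_block_mat A2 (0\<^sub>m k m) (0\<^sub>m m k) D2 =
    four_block_mat (A1 * A2) (0\<^sub>m k m) (0\<^sub>m m k) (D1 * D2)"
  using assms by (subst mult_four_block_mat[where ?nr1.0 = k and ?n1.0 = k and ?n2.0 = m
      and ?nr2.0 = m and ?nc1.0 = k and ?nc2.0 = m]) auto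

text \<open>Conjugating by the direct sum of the identity and \<open>U\<close> leaves the upper
  block alone, which lets the induction work on the lower block only.\<close>

lemma unitarily_similar_four_block:
  assumes B: "B \<in> carrier_mat k k" and M: "M \<in> carrier_mat m m" and s: "unitarily_similar M K"
  shows "unitarily_similar (four_block_mat B (0\<^sub>m k m) (0\<^sub>m m k) M)
    (four_block_mat B (0\<^sub>m k m) (0\<^sub>m m k) K)"
proof -
  obtain U where U: "K \<in> carrier_mat m m" "U \<in> carrier_mat m m" "unitary_mat U"
    "K = U * M * mat_star U"
    using unitarily_similar_carrier[OF s M] .
  let ?U = "four_block_mat (1\<^sub>m k) (0\<^sub>m k m) (0\<^sub>m m k) U"
  have one: "mat_star (1\<^sub>m k) = (1\<^sub>m k)" by (intro eq_matI) auto
  have c: "?U \<in> carrier_mat (k + m) (k + m)" "mat_star U \<in> carrier_mat m m" using U by auto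
  have "unitary_mat ?U" using U c
    by (subst unitary_mat_iff[OF c(1)])
      (simp add: mat_star_four_block one mult_block_diag unitary_mat_iff[of _ m])
  moreover have "four_block_mat B (0\<^sub>m k m) (0\<^sub>m m k) K =
      ?U * four_block_mat B (0\<^sub>m k m) (0\<^sub>m m k) M * mat_star ?U"
    using U c B M by (simp add: mat_star_four_block one mult_block_diag[of _ k])
  ultimately show ?thesis
    using unitarily_similarI[of "four_block_mat B (0\<^sub>m k m) (0\<^sub>m m k) M" "k + m" ?U] c B M by simp
qed

section \<open>Completion to a unitary matrix\<close>

lemma adj_cscalar_prod:
  assumes A: "A \<in> carrier_mat n m" and x: "x \<in> carrier_vec m" and y: "y \<in> carrier_vec n"
  shows "(A *\<^sub>v x) \<bullet>c y = x \<bullet>c (adj A *\<^sub>v y)"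
proof -
  have "(A *\<^sub>v x) \<bullet> conjugate y = conjugate y \<bullet> (A *\<^sub>v x)"
    using A x y by (intro comm_scalar_prod[of _ n]) auto
  also have "\<dots> = (transpose_mat A *\<^sub>v conjugate y) \<bullet> x"
    using transpose_vec_mult_scalar[OF A x, of "conjugate y"] y by simp
  also have "\<dots> = x \<bullet> (transpose_mat A *\<^sub>v conjugate y)"
    using A x y by (intro comm_scalar_prod[of _ m]) auto
  also have "transpose_mat A *\<^sub>v conjugate y = conjugate (adj A *\<^sub>v y)"
    using A y by (intro eq_vecI) (auto simp: scalar_prod_def)
  finally show ?thesis .
qed

lemma conjugate_mult_mat_vec:
  assumes "A \<in> carrier_mat n m" and "x \<in> carrier_vec m"
  shows "conjugate (A *\<^sub>v x) = cnj_mat A *\<^sub>v conjugate x"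
  using assms by (intro eq_vecI) (auto simp: scalar_prod_def)

lemma cscalar_prod_swap:
  assumes "x \<in> carrier_vec n" and "y \<in> carrier_vec n"
  shows "(y :: complex vec) \<bullet>c x = cnj (x \<bullet>c y)"
  using assms by (auto simp: scalar_prod_def mult.commute)

text \<open>With \<open>w = x - y\<close>, the map \<open>v \<mapsto> v - (w\<^sup>*v / w\<^sup>*x) w\<close> is a complex analogue of a Householder
  reflection. It needs no phase normalisation of \<open>x\<close> and \<open>y\<close>, since
  \<open>\<parallel>w\<parallel>\<^sup>2 = 2 Re (w\<^sup>*x)\<close> already makes it unitary.\<close>

lemma exists_unitary_moving:
  fixes x y :: "complex vec"
  assumes x: "x \<in> carrier_vec n" and y: "y \<in> carrier_vec n"
    and x1: "x \<bullet>c x = 1" and y1: "y \<bullet>c y = 1"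
  shows "\<exists>V \<in> carrier_mat n n. V * adj V = 1\<^sub>m n \<and> V *\<^sub>v x = y \<and>
    (\<forall>z \<in> carrier_vec n. z \<bullet>c x = 0 \<longrightarrow> z \<bullet>c y = 0 \<longrightarrow> V *\<^sub>v z = z)"
proof (cases "x = y")
  case True
  have "adj (1\<^sub>m n) = 1\<^sub>m n" by (intro eq_matI) auto
  with True x show ?thesis by (intro bexI[of _ "1\<^sub>m n"]) auto
next
  case False
  define w where "w = x - y"
  have w: "w \<in> carrier_vec n" using x y unfolding w_def by auto
  have wi: "w $ i = x $ i - y $ i" if "i < n" for i using that x y unfolding w_def by auto
  define a where "a = x \<bullet>c w"
  have wz: "z \<bullet>c w = z \<bullet>c x - z \<bullet>c y" if z: "z \<in> carrier_vec n" for z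
    using z x y w by (auto simp: scalar_prod_def wi sum_subtractf algebra_simps)
  have yx: "y \<bullet>c x = cnj (x \<bullet>c y)" using cscalar_prod_swap[OF x y] .
  have a: "a = 1 - x \<bullet>c y" unfolding a_def using wz[OF x] x1 by simp
  have "w \<bullet>c w = x \<bullet>c w - y \<bullet>c w"
    using x y w by (auto simp: scalar_prod_def wi sum_subtractf algebra_simps)
  then have ww: "w \<bullet>c w = a + cnj a" using wz[OF x] wz[OF y] x1 y1 yx a by simp
  \<comment> \<open>Division by \<open>a\<close> is safe: \<open>a = 0\<close> would give
    \<open>w\<close> norm zero, hence \<open>x = y\<close>.\<close>
  have a0: "a \<noteq> 0"
  proof
    assume "a = 0"
    with ww have "w = 0\<^sub>v n" using conjugate_square_eq_0_vec[OF w] by simp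
    then have "x $ i = y $ i" if "i < n" for i using wi[OF that] that by simp
    with False x y show False by (auto intro!: eq_vecI)
  qed
  define V where "V = mat n n (\<lambda>(i, j). (if i = j then 1 else 0) - w $ i * cnj (w $ j) / a)"
  have V: "V \<in> carrier_mat n n" unfolding V_def by simp
  have Vz: "V *\<^sub>v z = z - ((z \<bullet>c w) / a) \<cdot>\<^sub>v w" if z: "z \<in> carrier_vec n" for z
  proof (rule eq_vecI)
    fix i assume i: "i < dim_vec (z - ((z \<bullet>c w) / a) \<cdot>\<^sub>v w)"
    have "(V *\<^sub>v z) $ i = (\<Sum>j = 0..<n. (if i = j then z $ j else 0) - w $ i * cnj (w $ j) / a * z $ j)"
      using i w z unfolding V_def by (auto simp: scalar_prod_def algebra_simps intro!: sum.cong)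
    also have "\<dots> = z $ i - w $ i / a * (\<Sum>j = 0..<n. z $ j * cnj (w $ j))"
      using i w by (auto simp: sum_subtractf sum_distrib_left algebra_simps intro!: sum.cong)
    finally show "(V *\<^sub>v z) $ i = (z - ((z \<bullet>c w) / a) \<cdot>\<^sub>v w) $ i"
      using i w z by (auto simp: scalar_prod_def)
  qed (use w z V in auto)
  have "V * adj V = 1\<^sub>m n"
  proof (rule eq_matI)
    fix i j assume "i < dim_row (1\<^sub>m n)" and "j < dim_col (1\<^sub>m n)"
    then have i: "i < n" and j: "j < n" by auto
    have "(V * adj V) $$ (i, j) =
      (\<Sum>k = 0..<n. ((if i = k then 1 else 0) - w $ i * cnj (w $ k) / a) *
         ((if j = k then 1 else 0) - cnj (w $ j) * w $ k / cnj a))"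
      using i j unfolding V_def by (auto simp: scalar_prod_def intro!: sum.cong)
    also have "\<dots> = (\<Sum>k = 0..<n. (if i = k then if j = k then 1 else 0 else 0)
        - (if i = k then cnj (w $ j) * w $ i / cnj a else 0)
        - (if j = k then w $ i * cnj (w $ j) / a else 0)
        + w $ i * cnj (w $ j) / (a * cnj a) * (w $ k * cnj (w $ k)))"
      by (intro sum.cong) (auto simp: algebra_simps)
    also have "\<dots> = (if i = j then 1 else 0) - cnj (w $ j) * w $ i / cnj a
        - w $ i * cnj (w $ j) / a + w $ i * cnj (w $ j) / (a * cnj a) * (w \<bullet>c w)"
      using i j w
      by (simp add: sum.distrib sum_subtractf sum_distrib_left[symmetric]
          sum_divide_distrib[symmetric] scalar_prod_def)
    \<comment> \<open>The correction terms cancel because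
      \<open>1 / a + 1 / cnj a = (a + cnj a) / (a * cnj a)\<close>.\<close>
    also have "\<dots> = (if i = j then 1 else 0)"
      unfolding ww using a0 by (simp add: field_simps)
    finally show "(V * adj V) $$ (i, j) = 1\<^sub>m n $$ (i, j)" using i j by simp
  qed (use V in auto)
  moreover have "V *\<^sub>v x = y"
    using a0 Vz[OF x] x y unfolding a_def[symmetric] by (auto simp: w_def)
  moreover have "V *\<^sub>v z = z" if "z \<in> carrier_vec n" "z \<bullet>c x = 0" "z \<bullet>c y = 0" for z
    using Vz[OF that(1)] wz[OF that(1)] that w by auto
  ultimately show ?thesis using V by auto
qed

lemma unitary_preserves_cscalar_prod:
  assumes V: "V \<in> carrier_mat n n" "V * adj V = 1\<^sub>m n"
    and x: "x \<in> carrier_vec n" and y: "y \<in> carrier_vec n"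
  shows "(V *\<^sub>v x) \<bullet>c (V *\<^sub>v y) = x \<bullet>c y"
proof -
  have "adj V * V = 1\<^sub>m n" by (rule mat_mult_left_right_inverse) (use V in auto)
  then have "adj V *\<^sub>v (V *\<^sub>v y) = y"
    using V y by (simp flip: assoc_mult_mat_vec[of _ n n _ n])
  then show ?thesis using V x y by (subst adj_cscalar_prod[of _ n n]) auto
qed

lemma adj_mult:
  assumes "A \<in> carrier_mat m n" and "B \<in> carrier_mat n k"
  shows "adj (A * B) = adj B * adj A"
  using assms by (intro eq_matI) (auto simp: scalar_prod_def mult.commute)

lemma conjugate_unit_vec [simp]: "conjugate (unit_vec n i) = (unit_vec n i :: complex vec)"
  by (intro eq_vecI) (auto simp: unit_vec_def)

text \<open>Two successive moves: the first takes \<open>x\<close> to its target, the second takes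
  the image of \<open>y\<close> to the other unit vector. The second fixes
  \<open>unit_vec n 0\<close>, which is orthogonal both to that image and to
  \<open>unit_vec n 1\<close>.\<close>

lemma exists_unitary_moving2:
  fixes x y :: "complex vec"
  assumes x: "x \<in> carrier_vec n" and y: "y \<in> carrier_vec n"
    and x1: "x \<bullet>c x = 1" and y1: "y \<bullet>c y = 1" and xy: "y \<bullet>c x = 0" and n: "1 < n"
  shows "\<exists>V \<in> carrier_mat n n. V * adj V = 1\<^sub>m n \<and>
    V *\<^sub>v x = unit_vec n 0 \<and> V *\<^sub>v y = unit_vec n 1"
proof -
  let ?e = "unit_vec n :: nat \<Rightarrow> complex vec"
  obtain V where V: "V \<in> carrier_mat n n" "V * adj V = 1\<^sub>m n" "V *\<^sub>v x = ?e 0"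
    using exists_unitary_moving[OF x _ x1, of "?e 0"] n by auto
  define y' where "y' = V *\<^sub>v y"
  have y': "y' \<in> carrier_vec n" using V y unfolding y'_def by auto
  have y'1: "y' \<bullet>c y' = 1" and y'0: "y' \<bullet>c ?e 0 = 0"
    unfolding y'_def V(3)[symmetric]
    using unitary_preserves_cscalar_prod[OF V(1,2)] x y y1 xy by auto
  obtain W where W: "W \<in> carrier_mat n n" "W * adj W = 1\<^sub>m n" "W *\<^sub>v y' = ?e 1"
    and Wz: "\<forall>z \<in> carrier_vec n. z \<bullet>c y' = 0 \<longrightarrow> z \<bullet>c ?e 1 = 0 \<longrightarrow> W *\<^sub>v z = z"
    using exists_unitary_moving[OF y' _ y'1, of "?e 1"] n by auto
  have "W *\<^sub>v ?e 0 = ?e 0"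
    using Wz y'0 cscalar_prod_swap[of "?e 0" n y'] y' n by (simp add: cscalar_prod_swap[of y' n "?e 0"])
  moreover have "W * V * adj (W * V) = 1\<^sub>m n"
  proof -
    have "W * V * (adj V * adj W) = W * (V * adj V) * adj W"
      using W(1) V(1) by (simp add: assoc_mult_mat[of _ n n _ n _ n])
    then show ?thesis using W V by (simp add: adj_mult[of _ n n _ n])
  qed
  ultimately show ?thesis using W V x y y'_def
    by (intro bexI[of _ "W * V"]) (auto simp: assoc_mult_mat_vec[of _ n n _ n])
qed

section \<open>Splitting off blocks\<close>

lemma exists_unit_multiple:
  fixes z :: "complex vec"
  assumes z: "z \<in> carrier_vec n" "z \<noteq> 0\<^sub>v n"
  shows "\<exists>c. (c \<cdot>\<^sub>v z) \<bullet>c (c \<cdot>\<^sub>v z) = 1"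
proof -
  have "z \<bullet>c z > 0" using z by simp
  \<comment> \<open>In the order on the complex numbers, positivity includes being real.\<close>
  then obtain r where r: "z \<bullet>c z = of_real r" "r > 0"
    by (metis complex_is_Real_iff Reals_cases less_complex_def complex.sel Re_complex_of_real
        zero_complex.sel)
  let ?c = "complex_of_real (1 / sqrt r)"
  have "(?c \<cdot>\<^sub>v z) \<bullet>c (?c \<cdot>\<^sub>v z) = ?c * cnj ?c * (z \<bullet>c z)"
    using z by (simp add: conjugate_smult_vec)
  also have "\<dots> = 1" using r by (simp flip: of_real_mult)
  finally show ?thesis by blast
qed

text \<open>For commuting Hermitian \<open>A\<close> and \<open>M\<close> the matrix \<open>A + \<i>M\<close> is normal, so that any
  eigenvector of it, with eigenvalue \<open>\<nu>\<close>, is an eigenvector of \<open>A\<close> for \<open>Re \<nu>\<close> and of \<open>M\<close>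
  for \<open>Im \<nu>\<close>.\<close>

lemma commuting_hermitian_common_eigenvector:
  fixes A M :: "complex mat"
  assumes A: "A \<in> carrier_mat n n" and M: "M \<in> carrier_mat n n"
    and hA: "adj A = A" and hM: "adj M = M" and comm: "A * M = M * A" and n: "n > 0"
  obtains x and a m :: real where "x \<in> carrier_vec n" "x \<bullet>c x = 1"
    "A *\<^sub>v x = of_real a \<cdot>\<^sub>v x" "M *\<^sub>v x = of_real m \<cdot>\<^sub>v x"
proof -
  define N where "N = A + \<i> \<cdot>\<^sub>m M"
  have N: "N \<in> carrier_mat n n" using A M unfolding N_def by auto
  obtain nu z0 where "eigenvector N z0 nu"
    using spectrum_non_empty[OF N n] unfolding spectrum_def eigenvalue_def by auto
  then have z0: "z0 \<in> carrier_vec n" "z0 \<noteq> 0\<^sub>v n" and Nz0: "N *\<^sub>v z0 = nu \<cdot>\<^sub>v z0"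
    using N unfolding eigenvector_def by auto
  obtain c where c: "(c \<cdot>\<^sub>v z0) \<bullet>c (c \<cdot>\<^sub>v z0) = 1" using exists_unit_multiple[OF z0] by blast
  define z where "z = c \<cdot>\<^sub>v z0"
  have z: "z \<in> carrier_vec n" and z1: "z \<bullet>c z = 1" using z0 c unfolding z_def by auto
  have Nz: "N *\<^sub>v z = nu \<cdot>\<^sub>v z"
    unfolding z_def using mult_mat_vec[OF N z0(1)] Nz0
    by (simp add: smult_smult_assoc mult.commute)
  \<comment> \<open>Shifts by the real and imaginary parts of the eigenvalue. They are real, so
    \<open>P\<close> and \<open>Q\<close> stay Hermitian; it remains to show \<open>P z = 0\<close>
    and \<open>Q z = 0\<close>.\<close>
  define P where "P = A + of_real (- Re nu) \<cdot>\<^sub>m 1\<^sub>m n"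
  define Q where "Q = M + of_real (- Im nu) \<cdot>\<^sub>m 1\<^sub>m n"
  have P: "P \<in> carrier_mat n n" and Q: "Q \<in> carrier_mat n n"
    using A M unfolding P_def Q_def by auto
  have hP: "adj P = P" unfolding P_def
  proof (rule eq_matI)
    fix i j assume "i < dim_row (A + of_real (- Re nu) \<cdot>\<^sub>m 1\<^sub>m n)"
      "j < dim_col (A + of_real (- Re nu) \<cdot>\<^sub>m 1\<^sub>m n)"
    moreover from this have "adj A $$ (i, j) = A $$ (i, j)" using hA by simp
    ultimately show "adj (A + of_real (- Re nu) \<cdot>\<^sub>m 1\<^sub>m n) $$ (i, j) =
      (A + of_real (- Re nu) \<cdot>\<^sub>m 1\<^sub>m n) $$ (i, j)"
      using A by auto
  qed (use A in auto)
  have hQ: "adj Q = Q" unfolding Q_def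
  proof (rule eq_matI)
    fix i j assume "i < dim_row (M + of_real (- Im nu) \<cdot>\<^sub>m 1\<^sub>m n)"
      "j < dim_col (M + of_real (- Im nu) \<cdot>\<^sub>m 1\<^sub>m n)"
    moreover from this have "adj M $$ (i, j) = M $$ (i, j)" using hM by simp
    ultimately show "adj (M + of_real (- Im nu) \<cdot>\<^sub>m 1\<^sub>m n) $$ (i, j) =
      (M + of_real (- Im nu) \<cdot>\<^sub>m 1\<^sub>m n) $$ (i, j)"
      using M by auto
  qed (use M in auto)
  have shift: "(X + k \<cdot>\<^sub>m 1\<^sub>m n) *\<^sub>v v = X *\<^sub>v v + k \<cdot>\<^sub>v v"
    if "X \<in> carrier_mat n n" "v \<in> carrier_vec n" for X :: "complex mat" and k v
    using that by (subst add_mult_distrib_mat_vec[of _ n n]) (auto simp: mult_mat_vec_def)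
  have PQ: "P * Q = Q * P" unfolding P_def Q_def using A M comm
    by (simp add: add_mult_distrib_mat[of _ n n _ _ n] mult_add_distrib_mat[of _ n n _ n]
        mult_smult_assoc_mat[of _ n n _ n] mult_smult_distrib[of _ n n _ n])
      (auto simp: algebra_simps intro!: eq_matI)
  define p where "p = P *\<^sub>v z"
  define q where "q = Q *\<^sub>v z"
  have pc: "p \<in> carrier_vec n" and qc: "q \<in> carrier_vec n"
    using P Q z unfolding p_def q_def by auto
  have pz: "p = A *\<^sub>v z + of_real (- Re nu) \<cdot>\<^sub>v z" and qz: "q = M *\<^sub>v z + of_real (- Im nu) \<cdot>\<^sub>v z"
    unfolding p_def q_def P_def Q_def using shift A M z by auto
  have Nz': "N *\<^sub>v z = A *\<^sub>v z + \<i> \<cdot>\<^sub>v (M *\<^sub>v z)"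
    unfolding N_def using A M z by (subst add_mult_distrib_mat_vec[of _ n n]) auto
  \<comment> \<open>The eigenvalue equation for \<open>N\<close> regroups as
    \<open>P z + \<i> Q z = 0\<close>.\<close>
  have pq: "p = (- \<i>) \<cdot>\<^sub>v q"
  proof (rule eq_vecI)
    fix i assume "i < dim_vec ((- \<i>) \<cdot>\<^sub>v q)"
    then have i: "i < n" using qc by simp
    have "(A *\<^sub>v z + \<i> \<cdot>\<^sub>v (M *\<^sub>v z)) $ i = nu * z $ i"
      using Nz Nz' i z by simp
    then have e: "(A *\<^sub>v z) $ i + \<i> * (M *\<^sub>v z) $ i = nu * z $ i"
      using i A M by simp
    have "nu = of_real (Re nu) + \<i> * of_real (Im nu)" by (simp add: complex_eq_iff)
    with e have "(A *\<^sub>v z) $ i + \<i> * (M *\<^sub>v z) $ i =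
        (of_real (Re nu) + \<i> * of_real (Im nu)) * z $ i" by simp
    then have "(A *\<^sub>v z) $ i - of_real (Re nu) * z $ i =
        - \<i> * ((M *\<^sub>v z) $ i - of_real (Im nu) * z $ i)"
      by (simp add: algebra_simps)
    then show "p $ i = ((- \<i>) \<cdot>\<^sub>v q) $ i"
      unfolding pz qz using i A M z by (simp del: index_mult_mat_vec)
  qed (use pc qc in auto)
  \<comment> \<open>As \<open>P\<close> and \<open>Q\<close> commute,
    \<open>P p = - \<i> P q = - \<i> Q p = - Q q\<close>.\<close>
  have "P *\<^sub>v p = (- \<i>) \<cdot>\<^sub>v (P *\<^sub>v q)" using pq P qc mult_mat_vec by metis
  also have "P *\<^sub>v q = Q *\<^sub>v p"
    unfolding p_def q_def using P Q z PQ by (metis assoc_mult_mat_vec)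
  also have "Q *\<^sub>v p = (- \<i>) \<cdot>\<^sub>v (Q *\<^sub>v q)" using pq Q qc mult_mat_vec by metis
  also have "(- \<i>) \<cdot>\<^sub>v ((- \<i>) \<cdot>\<^sub>v (Q *\<^sub>v q)) = (- 1) \<cdot>\<^sub>v (Q *\<^sub>v q)"
    by (simp add: smult_smult_assoc)
  finally have PpQq: "P *\<^sub>v p = (- 1) \<cdot>\<^sub>v (Q *\<^sub>v q)" .
  \<comment> \<open>Pairing with \<open>z\<close> makes the squared norm of \<open>p\<close> minus
    that of \<open>q\<close>, so both vanish.\<close>
  have "p \<bullet>c p = (P *\<^sub>v p) \<bullet>c z"
    using adj_cscalar_prod[OF P pc z] hP unfolding p_def by simp
  also have "\<dots> = - ((Q *\<^sub>v q) \<bullet>c z)"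
    unfolding PpQq using Q qc z by (auto simp: scalar_prod_def sum_negf)
  also have "(Q *\<^sub>v q) \<bullet>c z = q \<bullet>c q"
    using adj_cscalar_prod[OF Q qc z] hQ unfolding q_def by simp
  finally have "p \<bullet>c p = - (q \<bullet>c q)" .
  moreover have "p \<bullet>c p \<ge> 0" "q \<bullet>c q \<ge> 0" by (rule conjugate_square_ge_0_vec)+
  ultimately have "q \<bullet>c q = 0" "p \<bullet>c p = 0"
    by (auto simp: less_eq_complex_def complex_eq_iff)
  then have p0: "p = 0\<^sub>v n" and q0: "q = 0\<^sub>v n" using pc qc by auto
  have "A *\<^sub>v z = of_real (Re nu) \<cdot>\<^sub>v z"
  proof (rule eq_vecI)
    fix i assume "i < dim_vec (of_real (Re nu) \<cdot>\<^sub>v z)"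
    then have i: "i < n" using z by simp
    then have "p $ i = 0" using p0 by simp
    then show "(A *\<^sub>v z) $ i = (of_real (Re nu) \<cdot>\<^sub>v z) $ i"
      unfolding pz using i A z by (simp del: index_mult_mat_vec)
  qed (use A z in auto)
  moreover have "M *\<^sub>v z = of_real (Im nu) \<cdot>\<^sub>v z"
  proof (rule eq_vecI)
    fix i assume "i < dim_vec (of_real (Im nu) \<cdot>\<^sub>v z)"
    then have i: "i < n" using z by simp
    then have "q $ i = 0" using q0 by simp
    then show "(M *\<^sub>v z) $ i = (of_real (Im nu) \<cdot>\<^sub>v z) $ i"
      unfolding qz using i M z by (simp del: index_mult_mat_vec)
  qed (use M z in auto)
  ultimately show ?thesis using that z z1 by blast
qed

section \<open>Reducing subspaces of dimension one or two\<close>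

text \<open>\<open>adj V\<close> sends the unit vector back to \<open>x\<close>, so its entrywise
  conjugate \<open>transpose_mat V\<close> sends it to \<open>conjugate x\<close>. Columns of the
  transformed matrices can thus be computed from \<open>x\<close>.\<close>

lemma unitary_congruence_mult_vec:
  assumes A: "A \<in> carrier_mat n n" and V: "V \<in> carrier_mat n n" "V * adj V = 1\<^sub>m n"
    and x: "x \<in> carrier_vec n" and e: "V *\<^sub>v x = unit_vec n j"
  shows "(V * A * adj V) *\<^sub>v unit_vec n j = V *\<^sub>v (A *\<^sub>v x)"
    and "(V * A * transpose_mat V) *\<^sub>v unit_vec n j = V *\<^sub>v (A *\<^sub>v conjugate x)"
proof -
  have inv: "adj V * V = 1\<^sub>m n" by (rule mat_mult_left_right_inverse) (use V in auto)
  have c: "adj V \<in> carrier_mat n n" "transpose_mat V \<in> carrier_mat n n" using V by auto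
  have 1: "adj V *\<^sub>v unit_vec n j = x"
    using inv V(1) c x by (simp flip: e assoc_mult_mat_vec[of _ n n _ n])
  have "transpose_mat V = cnj_mat (adj V)" by simp
  then have 2: "transpose_mat V *\<^sub>v unit_vec n j = conjugate x"
    using conjugate_mult_mat_vec[OF c(1), of "unit_vec n j"] 1 by simp
  show "(V * A * adj V) *\<^sub>v unit_vec n j = V *\<^sub>v (A *\<^sub>v x)"
    using A V(1) c 1 by (simp add: assoc_mult_mat_vec[of _ n n _ n])
  show "(V * A * transpose_mat V) *\<^sub>v unit_vec n j = V *\<^sub>v (A *\<^sub>v conjugate x)"
    using A V(1) c 2 by (simp add: assoc_mult_mat_vec[of _ n n _ n])
qed

text \<open>The antilinear map \<open>J x = B conj(x)\<close> commutes with \<open>A\<close>, and \<open>J\<^sup>2\<close> is Hermitian and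
  negative semidefinite. A common unit eigenvector \<open>x\<close> of \<open>A\<close> and \<open>J\<^sup>2\<close>, with \<open>J\<^sup>2 x = -s\<^sup>2 x\<close>,
  spans with \<open>J x\<close> a subspace reducing \<open>A\<close> and \<open>J\<close>.\<close>

lemma commuting_parts_reduction:
  fixes A B :: "complex mat"
  assumes A: "A \<in> carrier_mat n n" and B: "B \<in> carrier_mat n n"
    and hA: "adj A = A" and aB: "transpose_mat B = - B"
    and comm: "A * B = B * cnj_mat A" and n: "n > 0"
  obtains V and l :: real where "V \<in> carrier_mat n n" "V * adj V = 1\<^sub>m n"
      "(V * A * adj V) *\<^sub>v unit_vec n 0 = of_real l \<cdot>\<^sub>v unit_vec n 0"
      "(V * B * transpose_mat V) *\<^sub>v unit_vec n 0 = 0\<^sub>v n"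
  | V and l s :: real where "V \<in> carrier_mat n n" "V * adj V = 1\<^sub>m n" "1 < n" "s > 0"
      "(V * A * adj V) *\<^sub>v unit_vec n 0 = of_real l \<cdot>\<^sub>v unit_vec n 0"
      "(V * A * adj V) *\<^sub>v unit_vec n 1 = of_real l \<cdot>\<^sub>v unit_vec n 1"
      "(V * B * transpose_mat V) *\<^sub>v unit_vec n 0 = of_real s \<cdot>\<^sub>v unit_vec n 1"
      "(V * B * transpose_mat V) *\<^sub>v unit_vec n 1 = of_real (- s) \<cdot>\<^sub>v unit_vec n 0"
proof -
  define M where "M = B * cnj_mat B"
  have cB: "cnj_mat B \<in> carrier_mat n n" and cA: "cnj_mat A \<in> carrier_mat n n" using A B by auto
  have M: "M \<in> carrier_mat n n" using B unfolding M_def by auto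
  have adjB: "adj B = - cnj_mat B" unfolding aB using B by (intro eq_matI) auto
  have adjcB: "adj (cnj_mat B) = - B" unfolding transpose_cnj_mat using aB by simp
  have hM: "adj M = M"
    unfolding M_def adj_mult[OF B cB] adjB adjcB using B by simp
  \<comment> \<open>The relation \<open>A B = B conj(A)\<close> is used once as it stands and once
    conjugated entrywise, so \<open>A\<close> commutes with the square of \<open>J\<close>.\<close>
  have "B * cnj_mat A * cnj_mat B = B * cnj_mat (A * B)"
    using A B cA cB by (simp add: cnj_mat_mult[of _ n n _ n] assoc_mult_mat[of _ n n _ n _ n])
  also have "\<dots> = B * (cnj_mat B * A)"
    unfolding comm using A B cA cB by (simp add: cnj_mat_mult[of _ n n _ n])
  also have "\<dots> = M * A"
    unfolding M_def using A B cB by simp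
  also have "B * cnj_mat A * cnj_mat B = A * M"
    unfolding M_def comm[symmetric] using A B cB by simp
  finally have "A * M = M * A" by simp
  from commuting_hermitian_common_eigenvector[OF A M hA hM this n]
  obtain x l m where x: "x \<in> carrier_vec n" and x1: "x \<bullet>c x = 1"
    and Ax: "A *\<^sub>v x = of_real l \<cdot>\<^sub>v x" and Mx: "M *\<^sub>v x = of_real m \<cdot>\<^sub>v x"
    by blast
  define b where "b = B *\<^sub>v conjugate x"
  have b: "b \<in> carrier_vec n" using B x unfolding b_def by auto
  have cb: "conjugate b = cnj_mat B *\<^sub>v x"
    unfolding b_def using conjugate_mult_mat_vec[OF B, of "conjugate x"] x by simp
  have Bcb: "B *\<^sub>v conjugate b = of_real m \<cdot>\<^sub>v x"
    unfolding cb using Mx B cB x unfolding M_def by simp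
  \<comment> \<open>Pairing \<open>J (J x)\<close> with \<open>x\<close> gives minus the squared
    norm of \<open>b = J x\<close>, and also \<open>m\<close>.\<close>
  have "(B *\<^sub>v conjugate b) \<bullet>c x = conjugate b \<bullet>c (adj B *\<^sub>v x)"
    using B b x by (intro adj_cscalar_prod) auto
  also have "adj B *\<^sub>v x = - conjugate b" unfolding adjB cb using cB x by simp
  also have "conjugate b \<bullet>c (- conjugate b) = - (b \<bullet>c b)"
    using b by (auto simp: scalar_prod_def sum_negf mult.commute)
  finally have bb: "b \<bullet>c b = - of_real m" unfolding Bcb using x x1 by simp
  then have m: "m \<le> 0" using conjugate_square_ge_0_vec[of b] by (simp add: less_eq_complex_def)
  \<comment> \<open>This is the antisymmetric bilinear form of \<open>B\<close> with
    \<open>conjugate x\<close> in both arguments, so it equals its own negative.\<close>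
  have bx: "b \<bullet>c x = 0"
  proof -
    have "b \<bullet> conjugate x = conjugate x \<bullet> (transpose_mat B *\<^sub>v conjugate x)"
      unfolding b_def using transpose_vec_mult_scalar[OF B, of "conjugate x" "conjugate x"] x B
      by (metis carrier_vec_conjugate comm_scalar_prod mult_mat_vec_carrier transpose_carrier_mat)
    also have "\<dots> = - (conjugate x \<bullet> b)" unfolding aB b_def using B x by simp
    also have "conjugate x \<bullet> b = b \<bullet> conjugate x" using x b by (intro comm_scalar_prod) auto
    finally show ?thesis by simp
  qed
  show ?thesis
  proof (cases "m = 0")
    \<comment> \<open>Here \<open>J x = 0\<close>, and the line through \<open>x\<close> alone
      reduces both maps.\<close>
    case True
    then have b0: "b = 0\<^sub>v n" using bb b by simp
    obtain V where V: "V \<in> carrier_mat n n" "V * adj V = 1\<^sub>m n" "V *\<^sub>v x = unit_vec n 0"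
      using exists_unitary_moving[OF x _ x1, of "unit_vec n 0"] n by auto
    show ?thesis
    proof (rule that(1)[OF V(1,2)])
      show "(V * A * adj V) *\<^sub>v unit_vec n 0 = of_real l \<cdot>\<^sub>v unit_vec n 0"
        unfolding unitary_congruence_mult_vec(1)[OF A V(1,2) x V(3)] Ax
        using mult_mat_vec[OF V(1) x] V(3) by simp
      show "(V * B * transpose_mat V) *\<^sub>v unit_vec n 0 = 0\<^sub>v n"
        unfolding unitary_congruence_mult_vec(2)[OF B V(1,2) x V(3)]
        using b0 V(1) unfolding b_def by (auto intro!: eq_vecI)
    qed
  next
    case False
    \<comment> \<open>\<open>s\<close> is the norm of \<open>J x\<close>, and \<open>y\<close> below
      is \<open>J x\<close> normalised.\<close>
    define s where "s = sqrt (- m)"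
    have s: "s > 0" "s * s = - m" using m False unfolding s_def by auto
    define y where "y = of_real (1 / s) \<cdot>\<^sub>v b"
    have y: "y \<in> carrier_vec n" using b unfolding y_def by auto
    have bsy: "b = of_real s \<cdot>\<^sub>v y" using s unfolding y_def by (simp add: smult_smult_assoc)
    have "y \<bullet>c y = of_real (1 / s) * of_real (1 / s) * (b \<bullet>c b)"
      unfolding y_def using b by (simp add: conjugate_smult_vec)
    also have "\<dots> = of_real ((1 / s) * (1 / s) * (s * s))"
      unfolding bb s(2) by simp
    also have "\<dots> = 1" using s(1) by simp
    finally have y1: "y \<bullet>c y = 1" .
    have yx: "y \<bullet>c x = 0" unfolding y_def using b x bx by simp
    \<comment> \<open>Two orthonormal vectors do not fit into dimension one.\<close>
    have n1: "1 < n"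
    proof (rule ccontr)
      assume "\<not> 1 < n"
      then have "n = 1" using n by simp
      then have "y $ 0 * cnj (x $ 0) = 0" "y $ 0 * cnj (y $ 0) = 1" "x $ 0 * cnj (x $ 0) = 1"
        using x y yx y1 x1 by (auto simp: scalar_prod_def)
      then show False by auto
    qed
    obtain V where V: "V \<in> carrier_mat n n" "V * adj V = 1\<^sub>m n"
      "V *\<^sub>v x = unit_vec n 0" "V *\<^sub>v y = unit_vec n 1"
      using exists_unitary_moving2[OF x y x1 y1 yx n1] by auto
    \<comment> \<open>\<open>A\<close> commutes with the antilinear \<open>J\<close>, and the
      eigenvalue \<open>l\<close> survives the conjugation because it is real.\<close>
    have Ab: "A *\<^sub>v b = of_real l \<cdot>\<^sub>v b"
    proof -
      have "A *\<^sub>v b = B *\<^sub>v (cnj_mat A *\<^sub>v conjugate x)"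
        unfolding b_def using A B cA x comm by (metis assoc_mult_mat_vec carrier_vec_conjugate)
      also have "cnj_mat A *\<^sub>v conjugate x = of_real l \<cdot>\<^sub>v conjugate x"
        using conjugate_mult_mat_vec[OF A x] unfolding Ax by (simp add: conjugate_smult_vec)
      finally show ?thesis unfolding b_def using B x by (simp add: mult_mat_vec[of _ n n])
    qed
    have Ay: "A *\<^sub>v y = of_real l \<cdot>\<^sub>v y"
      unfolding y_def mult_mat_vec[OF A b] Ab by (simp add: smult_smult_assoc mult.commute)
    \<comment> \<open>\<open>J y = J (J x) / s = (m / s) x = - s x\<close>, which is the sign in the
      upper right entry of \<open>delta_block\<close>.\<close>
    have "conjugate y = of_real (1 / s) \<cdot>\<^sub>v conjugate b"
      unfolding y_def by (simp add: conjugate_smult_vec)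
    then have "B *\<^sub>v conjugate y = of_real (1 / s) \<cdot>\<^sub>v (of_real m \<cdot>\<^sub>v x)"
      using B b Bcb by (simp add: mult_mat_vec[of _ n n])
    also have "\<dots> = of_real (1 / s * m) \<cdot>\<^sub>v x" by (simp add: smult_smult_assoc)
    also have "1 / s * m = - s" using s by (simp add: field_simps)
    finally have By: "B *\<^sub>v conjugate y = of_real (- s) \<cdot>\<^sub>v x" .
    show ?thesis
    proof (rule that(2)[OF V(1,2) n1 s(1)])
      show "(V * A * adj V) *\<^sub>v unit_vec n 0 = of_real l \<cdot>\<^sub>v unit_vec n 0"
        unfolding unitary_congruence_mult_vec(1)[OF A V(1,2) x V(3)] Ax
        using mult_mat_vec[OF V(1) x] V(3) by simp
      show "(V * A * adj V) *\<^sub>v unit_vec n 1 = of_real l \<cdot>\<^sub>v unit_vec n 1"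
        unfolding unitary_congruence_mult_vec(1)[OF A V(1,2) y V(4)] Ay
        using mult_mat_vec[OF V(1) y] V(4) by simp
      show "(V * B * transpose_mat V) *\<^sub>v unit_vec n 0 = of_real s \<cdot>\<^sub>v unit_vec n 1"
        unfolding unitary_congruence_mult_vec(2)[OF B V(1,2) x V(3)] b_def[symmetric] bsy
        using mult_mat_vec[OF V(1) y] V(4) by simp
      show "(V * B * transpose_mat V) *\<^sub>v unit_vec n 1 = of_real (- s) \<cdot>\<^sub>v unit_vec n 0"
        unfolding unitary_congruence_mult_vec(2)[OF B V(1,2) y V(4)] By
        using mult_mat_vec[OF V(1) x] V(3) by simp
    qed
  qed
qed

section \<open>Self-adjoint matrices whose two parts commute\<close>

lemma mult_unit_vec_eq_imp_col:
  fixes M :: "complex mat"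
  assumes "M \<in> carrier_mat n n" and "M *\<^sub>v unit_vec n j = v" and "i < n" and "j < n"
  shows "M $$ (i, j) = v $ i"
  using assms by auto

text \<open>The involution conjugates the complex part but only negates the \<delta> part, which
  makes the latter antisymmetric rather than Hermitian.\<close>

lemma self_adjoint_parts:
  assumes "self_adjoint_mat H"
  shows "adj (fst_mat H) = fst_mat H" and "transpose_mat (snd_mat H) = - snd_mat H"
proof -
  have h: "mat_star H = H" using assms unfolding self_adjoint_mat_def .
  show "adj (fst_mat H) = fst_mat H" using fst_mat_star[of H] unfolding h by simp
  show "transpose_mat (snd_mat H) = - snd_mat H" using snd_mat_star[of H] unfolding h
    by (metis uminus_uminus_mat)
qed

text \<open>Zeros below the leading block are enough, since self-adjointness reflects them to its
  right.\<close>

lemma self_adjoint_split: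
  assumes K: "K \<in> carrier_mat (k + m) (k + m)" and sa: "self_adjoint_mat K"
    and z: "\<And>i j. j < k \<Longrightarrow> k \<le> i \<Longrightarrow> i < k + m \<Longrightarrow> K $$ (i, j) = 0"
  obtains D where "D \<in> carrier_mat m m"
    "K = four_block_mat (mat k k (\<lambda>ij. K $$ ij)) (0\<^sub>m k m) (0\<^sub>m m k) D"
proof -
  have z': "K $$ (j, i) = 0" if "j < k" "k \<le> i" "i < k + m" for i j
  proof -
    have "K $$ (j, i) = mat_star K $$ (j, i)" using sa unfolding self_adjoint_mat_def by simp
    also have "\<dots> = 0" using that K z[OF that] by simp
    finally show ?thesis .
  qed
  show ?thesis
    by (rule that[of "mat m m (\<lambda>(i, j). K $$ (i + k, j + k))"])
      (use K z z' in \<open>auto intro!: eq_matI\<close>)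
qed

text \<open>For \<open>H = A + B\<delta>\<close> this says that \<open>A\<close> and
  \<open>B\<delta>\<close> commute over the algebra. It survives every complex unitary conjugation,
  as diagonality of \<open>A\<close> would not, and passes to diagonal blocks.\<close>

definition commuting_parts :: "cl011 mat \<Rightarrow> bool" where
  "commuting_parts H \<longleftrightarrow> fst_mat H * snd_mat H = snd_mat H * cnj_mat (fst_mat H)"

text \<open>Moving \<delta> to the right conjugates the factor \<open>adj V\<close> into
  \<open>transpose_mat V\<close>, so the \<delta> part transforms by congruence.\<close>

lemma cl_mat_conj_parts:
  assumes H: "H \<in> carrier_mat n n" and V: "V \<in> carrier_mat n n"
  shows "fst_mat (cl_mat V * H * mat_star (cl_mat V)) = V * fst_mat H * adj V"
    and "snd_mat (cl_mat V * H * mat_star (cl_mat V)) = V * snd_mat H * transpose_mat V"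
proof -
  have c: "cl_mat V \<in> carrier_mat n n" "cl_mat (adj V) \<in> carrier_mat n n"
    "transpose_mat V \<in> carrier_mat n n" "adj V \<in> carrier_mat n n"
    "fst_mat H \<in> carrier_mat n n" "snd_mat H \<in> carrier_mat n n"
    "cl_mat V * H \<in> carrier_mat n n" "cnj_mat (adj V) = transpose_mat V"
    using H V by auto
  show "fst_mat (cl_mat V * H * mat_star (cl_mat V)) = V * fst_mat H * adj V"
    using H V c by (simp add: mat_star_cl_mat fst_mat_mult[of _ n n _ n])
  show "snd_mat (cl_mat V * H * mat_star (cl_mat V)) = V * snd_mat H * transpose_mat V"
    using H V c
    by (simp add: mat_star_cl_mat fst_mat_mult[of _ n n _ n] snd_mat_mult[of _ n n _ n]
        snd_cl_mat[of _ n n])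
qed

text \<open>The inner factors cancel: \<open>adj V * V\<close> on one side, its entrywise conjugate
  \<open>transpose_mat V * cnj_mat V\<close> on the other.\<close>

lemma commuting_parts_cl_mat_conj:
  assumes H: "H \<in> carrier_mat n n" and V: "V \<in> carrier_mat n n" "V * adj V = 1\<^sub>m n"
    and comm: "commuting_parts H"
  shows "commuting_parts (cl_mat V * H * mat_star (cl_mat V))"
proof -
  define A B where "A = fst_mat H" and "B = snd_mat H"
  have c: "A \<in> carrier_mat n n" "B \<in> carrier_mat n n" "cnj_mat A \<in> carrier_mat n n"
    "adj V \<in> carrier_mat n n" "transpose_mat V \<in> carrier_mat n n" "cnj_mat V \<in> carrier_mat n n"
    using H V unfolding A_def B_def by auto
  have inv: "adj V * V = 1\<^sub>m n" by (rule mat_mult_left_right_inverse) (use V c in auto)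
  have "cnj_mat (adj V * V) = transpose_mat V * cnj_mat V"
    using V c by (simp add: cnj_mat_mult[of _ n n _ n])
  moreover have "cnj_mat (1\<^sub>m n) = 1\<^sub>m n" by (intro eq_matI) auto
  ultimately have inv': "transpose_mat V * cnj_mat V = 1\<^sub>m n" using inv by simp
  have "(V * A * adj V) * (V * B * transpose_mat V) =
      V * A * (adj V * V) * B * transpose_mat V"
    using V(1) c by (simp add: assoc_mult_mat[of _ n n _ n _ n])
  also have "\<dots> = V * (A * B) * transpose_mat V"
    unfolding inv using V(1) c by (simp add: assoc_mult_mat[of _ n n _ n _ n])
  also have "A * B = B * cnj_mat A"
    using comm unfolding commuting_parts_def A_def B_def .
  also have "V * (B * cnj_mat A) * transpose_mat V =
      V * B * (transpose_mat V * cnj_mat V) * cnj_mat A * transpose_mat V"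
    unfolding inv' using V(1) c by (simp add: assoc_mult_mat[of _ n n _ n _ n])
  also have "\<dots> = (V * B * transpose_mat V) * (cnj_mat V * cnj_mat A * transpose_mat V)"
    using V(1) c by (simp add: assoc_mult_mat[of _ n n _ n _ n])
  also have "cnj_mat V * cnj_mat A * transpose_mat V = cnj_mat (V * A * adj V)"
    using V(1) c by (simp add: cnj_mat_mult[of _ n n _ n])
  finally show ?thesis
    unfolding commuting_parts_def cl_mat_conj_parts[OF H V(1)] A_def B_def .
qed

lemma four_block_diag_inject:
  assumes "A \<in> carrier_mat k k" "D \<in> carrier_mat m m" "A' \<in> carrier_mat k k" "D' \<in> carrier_mat m m"
    and e: "four_block_mat A (0\<^sub>m k m) (0\<^sub>m m k) D = four_block_mat A' (0\<^sub>m k m) (0\<^sub>m m k) D'"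
  shows "D = D'"
proof (rule eq_matI)
  fix i j assume ij: "i < dim_row D'" "j < dim_col D'"
  have "four_block_mat A (0\<^sub>m k m) (0\<^sub>m m k) D $$ (i + k, j + k) =
    four_block_mat A' (0\<^sub>m k m) (0\<^sub>m m k) D' $$ (i + k, j + k)" using e by simp
  then show "D $$ (i, j) = D' $$ (i, j)" using assms(1-4) ij by auto
qed (use assms(1-4) in auto)

lemma map_mat_block_diag:
  assumes "f 0 = 0" and "A \<in> carrier_mat k k" and "D \<in> carrier_mat m m"
  shows "map_mat f (four_block_mat A (0\<^sub>m k m) (0\<^sub>m m k) D) =
    four_block_mat (map_mat f A) (0\<^sub>m k m) (0\<^sub>m m k) (map_mat f D)"
  using assms by (intro eq_matI) auto

lemma lower_block_properties:
  assumes B: "B \<in> carrier_mat k k" and D: "D \<in> carrier_mat m m"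
    and K: "K = four_block_mat B (0\<^sub>m k m) (0\<^sub>m m k) D"
  shows "self_adjoint_mat K \<Longrightarrow> self_adjoint_mat D"
    and "commuting_parts K \<Longrightarrow> commuting_parts D"
proof -
  show "self_adjoint_mat D" if "self_adjoint_mat K"
    using that B D four_block_diag_inject[of "mat_star B" k "mat_star D" m B D]
    unfolding self_adjoint_mat_def K mat_star_four_block[OF B D] by simp
  assume comm: "commuting_parts K"
  have c: "fst_mat B \<in> carrier_mat k k" "snd_mat B \<in> carrier_mat k k"
    "fst_mat D \<in> carrier_mat m m" "snd_mat D \<in> carrier_mat m m"
    "cnj_mat (fst_mat B) \<in> carrier_mat k k" "cnj_mat (fst_mat D) \<in> carrier_mat m m"
    using B D by auto
  have fK: "fst_mat K = four_block_mat (fst_mat B) (0\<^sub>m k m) (0\<^sub>m m k) (fst_mat D)"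
    and sK: "snd_mat K = four_block_mat (snd_mat B) (0\<^sub>m k m) (0\<^sub>m m k) (snd_mat D)"
    unfolding K by (rule map_mat_block_diag[OF _ B D], simp)+
  have cK: "cnj_mat (fst_mat K) =
      four_block_mat (cnj_mat (fst_mat B)) (0\<^sub>m k m) (0\<^sub>m m k) (cnj_mat (fst_mat D))"
    unfolding fK by (rule map_mat_block_diag[OF _ c(1,3)]) simp
  have "four_block_mat (fst_mat B * snd_mat B) (0\<^sub>m k m) (0\<^sub>m m k) (fst_mat D * snd_mat D) =
      four_block_mat (snd_mat B * cnj_mat (fst_mat B)) (0\<^sub>m k m) (0\<^sub>m m k)
        (snd_mat D * cnj_mat (fst_mat D))"
    using comm unfolding commuting_parts_def cK
    unfolding fK sK mult_block_diag[OF c(1,2,3,4)] mult_block_diag[OF c(2,5,4,6)] .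
  from four_block_diag_inject[OF _ _ _ _ this] show "commuting_parts D"
    unfolding commuting_parts_def using c by simp
qed

lemma real_block_eq: "real_block l = mat 1 1 (\<lambda>_. of_real l)"
  unfolding real_block_def mat_of_rows_list_def by (intro eq_matI) auto

lemma delta_block_eq:
  "delta_block l s = mat 2 2 (\<lambda>(i, j). if i = j then of_real l
    else if i = 0 then - (s *\<^sub>R cl_delta) else s *\<^sub>R cl_delta)"
  unfolding delta_block_def mat_of_rows_list_def
  by (intro eq_matI) (auto simp: less_2_cases_iff)

lemma of_real_cl: "(of_real r :: cl011) = Cl (of_real r) 0"
  by (simp add: cl011_defs of_real_def)

text \<open>\<open>commuting_parts_reduction\<close> prescribes the first one or two columns of a
  conjugate of \<open>H\<close>: the block with zeros below it. Self-adjointness clears the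
  rest.\<close>

lemma commuting_parts_split_off_block:
  assumes H: "H \<in> carrier_mat n n" and sa: "self_adjoint_mat H" and comm: "commuting_parts H"
    and n: "n > 0"
  obtains k m B D where "n = k + m" "k > 0" "B \<in> carrier_mat k k" "D \<in> carrier_mat m m"
    "(\<exists>l s. s > 0 \<and> B = delta_block l s) \<or> (\<exists>l. B = real_block l)"
    "self_adjoint_mat D" "commuting_parts D"
    "unitarily_similar H (four_block_mat B (0\<^sub>m k m) (0\<^sub>m m k) D)"
proof -
  note result = that
  \<comment> \<open>Common end of both cases: \<open>K\<close> has leading block \<open>B\<close>
    and zeros below it.\<close>
  have finish: thesis
    if V: "V \<in> carrier_mat n n" "V * adj V = 1\<^sub>m n" and nkm: "n = k + m" and k: "k > 0"
      and K: "K = cl_mat V * H * mat_star (cl_mat V)"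
      and B: "B = mat k k (\<lambda>ij. K $$ ij)"
      and Bs: "(\<exists>l s. s > 0 \<and> B = delta_block l s) \<or> (\<exists>l. B = real_block l)"
      and z: "\<And>i j. j < k \<Longrightarrow> k \<le> i \<Longrightarrow> i < k + m \<Longrightarrow> K $$ (i, j) = 0"
    for V k m B K
  proof -
    have us: "unitarily_similar H K" unfolding K
      using unitarily_similarI[OF H _ unitary_cl_mat[OF V]] V by simp
    have saK: "self_adjoint_mat K" using unitarily_similar_self_adjoint[OF us sa] .
    have cK: "commuting_parts K" unfolding K by (rule commuting_parts_cl_mat_conj[OF H V comm])
    have Kc: "K \<in> carrier_mat (k + m) (k + m)" using H V unfolding K nkm by auto
    obtain D where D: "D \<in> carrier_mat m m" "K = four_block_mat B (0\<^sub>m k m) (0\<^sub>m m k) D"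
      using self_adjoint_split[OF Kc saK z] unfolding B by blast
    have Bc: "B \<in> carrier_mat k k" unfolding B by simp
    show thesis
      using result[OF nkm k Bc D(1) Bs lower_block_properties(1)[OF Bc D saK]
          lower_block_properties(2)[OF Bc D cK]] us unfolding D(2) .
  qed
  define A where "A = fst_mat H"
  define B where "B = snd_mat H"
  have Ac: "A \<in> carrier_mat n n" and Bc: "B \<in> carrier_mat n n" using H unfolding A_def B_def by auto
  have entry: "(cl_mat V * H * mat_star (cl_mat V)) $$ (i, j) = Cl (a $ i) (b $ i)"
    if V: "V \<in> carrier_mat n n" and "i < n" "j < n"
      and a: "(V * A * adj V) *\<^sub>v unit_vec n j = a" and b: "(V * B * transpose_mat V) *\<^sub>v unit_vec n j = b"
    for V i j a b
  proof -
    let ?K = "cl_mat V * H * mat_star (cl_mat V)"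
    have "V * A * adj V \<in> carrier_mat n n" "V * B * transpose_mat V \<in> carrier_mat n n"
      using V Ac Bc by auto
    then have "fst_mat ?K $$ (i, j) = a $ i" "snd_mat ?K $$ (i, j) = b $ i"
      unfolding cl_mat_conj_parts[OF H V] A_def[symmetric] B_def[symmetric]
      using mult_unit_vec_eq_imp_col[OF _ a that(2,3)] mult_unit_vec_eq_imp_col[OF _ b that(2,3)]
      by blast+
    then show ?thesis using H V that(2,3) by (simp add: cl011.expand)
  qed
  have "A * B = B * cnj_mat A" using comm unfolding commuting_parts_def A_def B_def .
  from commuting_parts_reduction[OF Ac Bc _ _ this n] self_adjoint_parts[OF sa]
  consider V l where "V \<in> carrier_mat n n" "V * adj V = 1\<^sub>m n"
      "(V * A * adj V) *\<^sub>v unit_vec n 0 = of_real l \<cdot>\<^sub>v unit_vec n 0"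
      "(V * B * transpose_mat V) *\<^sub>v unit_vec n 0 = 0\<^sub>v n"
  | V and l s :: real where "V \<in> carrier_mat n n" "V * adj V = 1\<^sub>m n" "1 < n" "s > 0"
      "(V * A * adj V) *\<^sub>v unit_vec n 0 = of_real l \<cdot>\<^sub>v unit_vec n 0"
      "(V * A * adj V) *\<^sub>v unit_vec n 1 = of_real l \<cdot>\<^sub>v unit_vec n 1"
      "(V * B * transpose_mat V) *\<^sub>v unit_vec n 0 = of_real s \<cdot>\<^sub>v unit_vec n 1"
      "(V * B * transpose_mat V) *\<^sub>v unit_vec n 1 = of_real (- s) \<cdot>\<^sub>v unit_vec n 0"
    unfolding A_def B_def by metis
  then show thesis
  proof cases
    case (1 V l)
    define K where "K = cl_mat V * H * mat_star (cl_mat V)"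
    have e: "K $$ (i, 0) = (if i = 0 then of_real l else 0)" if "i < n" for i
      unfolding K_def entry[OF 1(1) that n 1(3,4)] using that
      by (simp add: of_real_cl zero_cl011_def)
    show thesis
    proof (rule finish[OF 1(1,2) _ _ K_def refl])
      show "n = 1 + (n - 1)" using n by simp
      show "(\<exists>l' s. s > 0 \<and> mat 1 1 (\<lambda>ij. K $$ ij) = delta_block l' s) \<or>
        (\<exists>l. mat 1 1 (\<lambda>ij. K $$ ij) = real_block l)"
        unfolding real_block_eq using e[of 0] n by (intro disjI2 exI[of _ l]) (auto intro!: eq_matI)
    qed (use e in auto)
  next
    case (2 V l s)
    define K where "K = cl_mat V * H * mat_star (cl_mat V)"
    have e0: "K $$ (i, 0) = (if i = 0 then of_real l else if i = 1 then s *\<^sub>R cl_delta else 0)"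
      if "i < n" for i
      unfolding K_def entry[OF 2(1) that n 2(5,7)] using that 2(3)
      by (simp add: of_real_cl zero_cl011_def scaleR_cl011_def cl_delta_def scaleR_conv_of_real)
    have e1: "K $$ (i, 1) = (if i = 0 then - (s *\<^sub>R cl_delta) else if i = 1 then of_real l else 0)"
      if "i < n" for i
      unfolding K_def entry[OF 2(1) that 2(3) 2(6,8)] using that 2(3)
      by (simp add: of_real_cl zero_cl011_def scaleR_cl011_def cl_delta_def scaleR_conv_of_real
          uminus_cl011_def)
    show thesis
    proof (rule finish[OF 2(1,2) _ _ K_def refl])
      show "n = 2 + (n - 2)" using 2(3) by simp
      have "mat 2 2 (\<lambda>ij. K $$ ij) = delta_block l s"
        unfolding delta_block_eq using e0 e1 2(3)
        by (intro eq_matI) (auto simp: less_2_cases_iff)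
      then show "(\<exists>l' s. s > 0 \<and> mat 2 2 (\<lambda>ij. K $$ ij) = delta_block l' s) \<or>
        (\<exists>l. mat 2 2 (\<lambda>ij. K $$ ij) = real_block l)" using 2(4) by blast
      show "K $$ (i, j) = 0" if "j < 2" "2 \<le> i" "i < 2 + (n - 2)" for i j
        using that e0[of i] e1[of i] by (auto simp: less_2_cases_iff)
    qed auto
  qed
qed

section \<open>Block form for commuting parts\<close>

text \<open>Induction on the size: every split removes a nonempty block, and the remainder inherits
  both hypotheses.\<close>

lemma commuting_parts_block_diagonalizable:
  assumes "H \<in> carrier_mat n n" and "self_adjoint_mat H" and "commuting_parts H"
  shows "\<exists>Bs. (\<forall>B \<in> set Bs. (\<exists>l s. s > 0 \<and> B = delta_block l s) \<or> (\<exists>l. B = real_block l)) \<and>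
    unitarily_similar H (diag_block_mat Bs)"
  using assms
proof (induction n arbitrary: H rule: less_induct)
  case (less n)
  show ?case
  proof (cases "n = 0")
    case True
    \<comment> \<open>The empty matrix is the direct sum of no blocks.\<close>
    have "unitary_mat (0\<^sub>m 0 0)" by (subst unitary_mat_iff[of _ 0]) auto
    moreover have "H \<in> carrier_mat 0 0" using less.prems(1) True by simp
    ultimately have "unitarily_similar H (0\<^sub>m 0 0 * H * mat_star (0\<^sub>m 0 0))"
      by (intro unitarily_similarI[of _ 0]) auto
    moreover have "0\<^sub>m 0 0 * H * mat_star (0\<^sub>m 0 0) = diag_block_mat []" by (intro eq_matI) auto
    ultimately show ?thesis by (intro exI[of _ "[]"]) (auto simp del: diag_block_mat.simps)
  next
    case False
    then obtain k m B D where nkm: "n = k + m" and k: "k > 0"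
      and B: "B \<in> carrier_mat k k" and D: "D \<in> carrier_mat m m"
      and Bf: "(\<exists>l s. s > 0 \<and> B = delta_block l s) \<or> (\<exists>l. B = real_block l)"
      and Dp: "self_adjoint_mat D" "commuting_parts D"
      and us: "unitarily_similar H (four_block_mat B (0\<^sub>m k m) (0\<^sub>m m k) D)"
      using commuting_parts_split_off_block[OF less.prems] by blast
    have "m < n" using nkm k by simp
    from less.IH[OF this D Dp] obtain Bs where
      Bs: "\<forall>B \<in> set Bs. (\<exists>l s. s > 0 \<and> B = delta_block l s) \<or> (\<exists>l. B = real_block l)"
      and D': "unitarily_similar D (diag_block_mat Bs)" by blast
    \<comment> \<open>The blocks in \<open>Bs\<close> have total size \<open>m\<close> because their
      direct sum is similar to \<open>D\<close>.\<close>
    have c: "diag_block_mat Bs \<in> carrier_mat m m" using unitarily_similar_carrier[OF D' D] by blast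
    then have "diag_block_mat (B # Bs) = four_block_mat B (0\<^sub>m k m) (0\<^sub>m m k) (diag_block_mat Bs)"
      using B by (simp add: Let_def)
    then have "unitarily_similar H (diag_block_mat (B # Bs))"
      using unitarily_similar_trans[OF us unitarily_similar_four_block[OF B D D']] by simp
    then show ?thesis using Bs Bf by (intro exI[of _ "B # Bs"]) auto
  qed
qed

section \<open>Diagonalising the complex part and reaching commuting parts\<close>

text \<open>Off its diagonal a block holds only multiples of \<delta>. Hence taking complex parts
  turns a block form into a diagonalisation.\<close>

lemma block_diag_fst_off_diagonal:
  assumes "\<forall>B \<in> set Bs. (\<exists>l s :: real. s > 0 \<and> B = delta_block l s) \<or> (\<exists>l. B = real_block l)"
    and "i < dim_row (diag_block_mat Bs)" and "j < dim_col (diag_block_mat Bs)" and "i \<noteq> j"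
  shows "cl_fst (diag_block_mat Bs $$ (i, j)) = 0"
  using assms
proof (induction Bs arbitrary: i j)
  case (Cons B Bs)
  have off: "cl_fst (B $$ (a, b)) = 0" if "a < dim_row B" "b < dim_col B" "a \<noteq> b" for a b
    using Cons.prems(1) that
    by (auto simp: delta_block_eq real_block_eq cl_delta_def scaleR_cl011_def)
  have sq: "dim_row B = dim_col B" using Cons.prems(1) by (auto simp: delta_block_eq real_block_eq)
  show ?case
    using Cons.prems Cons.IH[of "i - dim_row B" "j - dim_row B"] off[of i j] sq
    by (auto simp: Let_def)
qed auto

text \<open>With zero \<delta> part the two parts commute trivially, so the block form applies. The
  complex part of the unitary found is itself unitary, as \<open>fst_mat\<close> respects products
  and adjoints.\<close>

lemma hermitian_diagonalizable:
  assumes A: "A \<in> carrier_mat n n" and hA: "adj A = A"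
  obtains V where "V \<in> carrier_mat n n" "V * adj V = 1\<^sub>m n" "diagonal_mat (V * A * adj V)"
proof -
  have H: "cl_mat A \<in> carrier_mat n n" using A by simp
  have "self_adjoint_mat (cl_mat A)" unfolding self_adjoint_mat_def mat_star_cl_mat hA ..
  moreover have "commuting_parts (cl_mat A)"
    unfolding commuting_parts_def snd_cl_mat[OF A] using A by simp
  ultimately obtain Bs where
    Bs: "\<forall>B \<in> set Bs. (\<exists>l s. s > 0 \<and> B = delta_block l s) \<or> (\<exists>l. B = real_block l)"
    and us: "unitarily_similar (cl_mat A) (diag_block_mat Bs)"
    using commuting_parts_block_diagonalizable[OF H] by blast
  obtain U where c: "diag_block_mat Bs \<in> carrier_mat n n" and U: "U \<in> carrier_mat n n" "unitary_mat U"
    and e: "diag_block_mat Bs = U * cl_mat A * mat_star U"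
    using unitarily_similar_carrier[OF us H] .
  have sU: "mat_star U \<in> carrier_mat n n" using U by simp
  have "fst_mat (U * mat_star U) = fst_mat (1\<^sub>m n)" using U unitary_mat_iff[of U n] by simp
  moreover have "fst_mat (1\<^sub>m n) = 1\<^sub>m n" by (intro eq_matI) auto
  ultimately have inv: "fst_mat U * adj (fst_mat U) = 1\<^sub>m n"
    using fst_mat_mult[OF U(1) sU] by simp
  have "fst_mat (diag_block_mat Bs) = fst_mat U * A * adj (fst_mat U)"
    unfolding e using U sU H by (simp add: fst_mat_mult[of _ n n _ n])
  moreover have "diagonal_mat (fst_mat (diag_block_mat Bs))"
    unfolding diagonal_mat_def using block_diag_fst_off_diagonal[OF Bs] by auto
  ultimately show ?thesis using that[of "fst_mat U"] U inv by simp
qed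

text \<open>Conjugation by \<open>1 + W\<delta>\<close>, unitary since \<open>W\<close> is symmetric, fixes the complex part \<open>A\<close> and
  adds \<open>W conj(A) - A W\<close> to the \<open>\<delta>\<close> part \<open>B\<close>. For real diagonal \<open>A\<close> the choice
  \<open>W\<^sub>i\<^sub>j = B\<^sub>i\<^sub>j / (a\<^sub>i - a\<^sub>j)\<close> removes the entries of \<open>B\<close> with \<open>a\<^sub>i \<noteq> a\<^sub>j\<close>; it is symmetric
  because \<open>B\<close> is antisymmetric.\<close>

lemma diagonal_unitarily_similar_commuting:
  assumes H: "H \<in> carrier_mat n n" and sa: "self_adjoint_mat H" and dg: "diagonal_mat (fst_mat H)"
  obtains K where "unitarily_similar H K" "commuting_parts K"
proof -
  define a where "a i = cl_fst (H $$ (i, i))" for i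
  define b where "b i j = cl_snd (H $$ (i, j))" for i j
  have adg: "cl_fst (H $$ (i, j)) = (if i = j then a i else 0)" if "i < n" "j < n" for i j
    using dg H that unfolding diagonal_mat_def a_def by auto
  have star: "H $$ (i, j) = cl_star (H $$ (j, i))" if "i < n" "j < n" for i j
    using sa H that mat_star_index[of i H j] unfolding self_adjoint_mat_def by simp
  have ra: "cnj (a i) = a i" if "i < n" for i
    using star[OF that that] unfolding a_def by (metis cl_simps(11))
  have ab: "b i j = - b j i" if "i < n" "j < n" for i j
    using star[OF that] unfolding b_def by (metis cl_simps(12))
  \<comment> \<open>The default \<open>0\<close> leaves the \<delta> part untouched where the
    diagonal entries agree.\<close>
  define w where "w i j = (if a i = a j then 0 else b i j / (a i - a j))" for i j
  have sw: "w i j = w j i" if "i < n" "j < n" for i j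
    unfolding w_def using ab[OF that] by (simp add: field_simps)
  define U where "U = mat n n (\<lambda>(i, j). Cl (if i = j then 1 else 0) (w i j))"
  have U: "U \<in> carrier_mat n n" and sU: "mat_star U \<in> carrier_mat n n" unfolding U_def by auto
  have fU: "fst_mat U = 1\<^sub>m n" and fsU: "fst_mat (mat_star U) = 1\<^sub>m n"
    unfolding fst_mat_star unfolding U_def by (auto intro!: eq_matI)
  define W where "W = snd_mat U"
  have W: "W \<in> carrier_mat n n" unfolding W_def using U by simp
  \<comment> \<open>Symmetry of \<open>W\<close> gives \<open>mat_star U = 1 - W\<delta>\<close>,
    which is inverse to \<open>U\<close> because \<open>(W\<delta>)(W\<delta>) = 0\<close>.\<close>
  have ssU: "snd_mat (mat_star U) = - W"
    unfolding snd_mat_star W_def unfolding U_def using sw by (auto intro!: eq_matI)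
  have one: "cnj_mat (1\<^sub>m n) = 1\<^sub>m n" by (intro eq_matI) auto
  have f1: "fst_mat (1\<^sub>m n) = 1\<^sub>m n" "snd_mat (1\<^sub>m n) = 0\<^sub>m n n" by (auto intro!: eq_matI)
  have "U * mat_star U = 1\<^sub>m n"
    by (rule cl_mat_eqI) (use W in \<open>auto simp: fst_mat_mult[OF U sU] snd_mat_mult[OF U sU] fU fsU ssU
        W_def[symmetric] one f1 simp del: fst_mat_star snd_mat_star\<close>)
  moreover have "mat_star U * U = 1\<^sub>m n"
    by (rule cl_mat_eqI) (use W in \<open>auto simp: fst_mat_mult[OF sU U] snd_mat_mult[OF sU U] fU fsU ssU
        W_def[symmetric] one f1 simp del: fst_mat_star snd_mat_star\<close>)
  ultimately have uU: "unitary_mat U" using unitary_mat_iff[OF U] by simp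
  define A B where "A = fst_mat H" and "B = snd_mat H"
  have A: "A \<in> carrier_mat n n" and B: "B \<in> carrier_mat n n" using H unfolding A_def B_def by auto
  define K where "K = U * H * mat_star U"
  have UH: "U * H \<in> carrier_mat n n" using U H by simp
  have fK: "fst_mat K = A"
    unfolding K_def fst_mat_mult[OF UH sU] fst_mat_mult[OF U H] fU fsU A_def[symmetric]
    using A by simp
  have sK: "snd_mat K = - (A * W) + (B + W * cnj_mat A)"
    unfolding K_def snd_mat_mult[OF UH sU] snd_mat_mult[OF U H] fst_mat_mult[OF U H] fU fsU ssU
      A_def[symmetric] B_def[symmetric] W_def[symmetric] one
    using A B W by (simp add: right_mult_one_mat[of _ n n])
  have K: "K \<in> carrier_mat n n" unfolding K_def using UH sU by simp
  have Ad: "A = mat n n (\<lambda>(i, j). if i = j then a i else 0)"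
    unfolding A_def using H adg by (intro eq_matI) auto
  have AX: "(A * X) $$ (i, j) = a i * X $$ (i, j)" and XA: "(X * cnj_mat A) $$ (i, j) = X $$ (i, j) * a j"
    if "X \<in> carrier_mat n n" "i < n" "j < n" for X i j
    using that ra unfolding Ad
    by (auto simp: scalar_prod_def if_distrib if_distribR cong: if_cong)
  have Wij: "W $$ (i, j) = w i j" and Bij: "B $$ (i, j) = b i j" if "i < n" "j < n" for i j
    using that H unfolding W_def U_def B_def b_def by auto
  have sKij: "snd_mat K $$ (i, j) = (if a i = a j then b i j else 0)" if "i < n" "j < n" for i j
  proof -
    have "snd_mat K $$ (i, j) = - (a i * w i j) + (b i j + w i j * a j)"
      unfolding sK using that A B W by (simp add: AX XA Wij Bij del: index_mult_mat(1))
    also have "\<dots> = b i j - w i j * (a i - a j)" by (simp add: algebra_simps)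
    also have "\<dots> = (if a i = a j then b i j else 0)" unfolding w_def by simp
    finally show ?thesis .
  qed
  have Kc: "snd_mat K \<in> carrier_mat n n" using K by simp
  \<comment> \<open>The two sides scale the entries of the \<delta> part by \<open>a i\<close> and
    by \<open>a j\<close>, which agree wherever an entry is nonzero.\<close>
  have "A * snd_mat K = snd_mat K * cnj_mat A"
  proof (rule eq_matI)
    fix i j assume "i < dim_row (snd_mat K * cnj_mat A)" "j < dim_col (snd_mat K * cnj_mat A)"
    then have ij: "i < n" "j < n" using K A by auto
    show "(A * snd_mat K) $$ (i, j) = (snd_mat K * cnj_mat A) $$ (i, j)"
      unfolding AX[OF Kc ij] XA[OF Kc ij] sKij[OF ij] by simp
  qed (use K A in auto)
  then have "commuting_parts K" unfolding commuting_parts_def fK .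
  moreover have "unitarily_similar H K" unfolding K_def by (rule unitarily_similarI[OF H U uU])
  ultimately show ?thesis using that by blast
qed

theorem theorem9p1:
  fixes H :: "cl011 mat"
  assumes "square_mat H" and "self_adjoint_mat H"
  shows "\<exists>Bs :: cl011 mat list.
    (\<forall>B \<in> set Bs.
      (\<exists>l l' :: real. l' > 0 \<and> B = delta_block l l') \<or> (\<exists>l :: real. B = real_block l)) \<and>
    unitarily_similar H (diag_block_mat Bs)"
proof -
  define n where "n = dim_row H"
  have H: "H \<in> carrier_mat n n" using assms(1) unfolding n_def by auto
  obtain V where V: "V \<in> carrier_mat n n" "V * adj V = 1\<^sub>m n"
    and dg: "diagonal_mat (V * fst_mat H * adj V)"
    using hermitian_diagonalizable[of "fst_mat H" n] H self_adjoint_parts(1)[OF assms(2)] by auto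
  \<comment> \<open>\<open>G\<close> has a diagonal complex part, as the conjugation by
    \<open>1 + W\<delta>\<close> requires.\<close>
  define G where "G = cl_mat V * H * mat_star (cl_mat V)"
  have HG: "unitarily_similar H G"
    unfolding G_def using unitarily_similarI[OF H _ unitary_cl_mat[OF V]] V by simp
  have G: "G \<in> carrier_mat n n" unfolding G_def using H V by simp
  have saG: "self_adjoint_mat G" using unitarily_similar_self_adjoint[OF HG assms(2)] .
  have "diagonal_mat (fst_mat G)" unfolding G_def cl_mat_conj_parts(1)[OF H V(1)] by (rule dg)
  from diagonal_unitarily_similar_commuting[OF G saG this]
  obtain K where GK: "unitarily_similar G K" and cK: "commuting_parts K" .
  have "K \<in> carrier_mat n n" using unitarily_similar_carrier[OF GK G] by blast
  from commuting_parts_block_diagonalizable[OF this unitarily_similar_self_adjoint[OF GK saG] cK]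
  obtain Bs where "\<forall>B \<in> set Bs. (\<exists>l l'. l' > 0 \<and> B = delta_block l l') \<or> (\<exists>l. B = real_block l)"
    and "unitarily_similar K (diag_block_mat Bs)" by blast
  then show ?thesis using unitarily_similar_trans[OF HG unitarily_similar_trans[OF GK]] by blast
qed

end
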